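(* Let $n$ be a positive integer. The groups $G_{n,d}^{2}$ and $G_{n+1}^{2}/\langle a_{i(n+1)}a_{j(n+1)}=a_{j(n+1)}a_{i(n+1)}\rangle$ are isomorphic.
   Context: Convention: generators are indexed by unordered pairs, so $a_{ji}$ means $a_{ij}$. For a positive integer $m$, $G_{m}^{2}$ is the group with generators $a_{ij}$ for $\{i,j\}\subset\{1,\dots,m\}$, $i<j$, and relations: (1) $a_{ij}^{2}=1$ for all $i\neq j$; (2) $a_{ij}a_{kl}=a_{kl}a_{ij}$ for distinct $i,j,k,l$; (3) $a_{ij}a_{ik}a_{jk}=a_{jk}a_{ik}a_{ij}$ for distinct $i,j,k$. $G_{n+1}^{2}/\langle a_{i(n+1)}a_{j(n+1)}=a_{j(n+1)}a_{i(n+1)}\rangle$ denotes the quotient of $G_{n+1}^{2}$ obtained by adding the relations $a_{i(n+1)}a_{j(n+1)}=a_{j(n+1)}a_{i(n+1)}$ for all $i,j\in\{1,\dots,n\}$. $G_{n,d}^{2}$ ($G_n^2$ with points) is the group with generators $a_{ij}$ for $\{i,j\}\subset\{1,\dots,n\}$, $i<j$, and $\tau_{i}$ for $i\in\{1,\dots,n\}$, and relations: (1) $a_{ij}^{2}=1$ for $i\neq j$; (2) $a_{ij}a_{kl}=a_{kl}a_{ij}$ for distinct $i,j,k,l$; (3) $a_{ij}a_{ik}a_{jk}=a_{jk}a_{ik}a_{ij}$ for distinct $i,j,k$; (4) $\tau_{i}^{2}=1$ for all $i$; (5) $\tau_{i}\tau_{j}=\tau_{j}\tau_{i}$ for all $i,j$;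 (6) $\tau_{i}\tau_{j}a_{ij}\tau_{j}\tau_{i}=a_{ij}$ for distinct $i,j$; (7) $a_{ij}\tau_{k}=\tau_{k}a_{ij}$ for distinct $i,j,k$. *)

theory Defs
  imports "HOL-Algebra.Coset"
begin

text \<open>A word is a list of letters; \<open>(x, True)\<close> stands for the generator \<open>x\<close> and
  \<open>(x, False)\<close> for its formal inverse.\<close>

type_synonym 'g word = "('g \<times> bool) list"

abbreviation words :: "'g set \<Rightarrow> 'g word set" where
  "words S \<equiv> lists (S \<times> UNIV)"

text \<open>A relation \<open>u = v\<close> is encoded as the pair \<open>(u, v)\<close>. Pairs in \<open>R\<close> that are not words over
  \<open>S\<close> are ignored.\<close>

inductive_set word_cong :: "'g set \<Rightarrow> ('g word \<times> 'g word) set \<Rightarrow> ('g word \<times> 'g word) set"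
  for S :: "'g set" and R :: "('g word \<times> 'g word) set" where
  refl: "w \<in> words S \<Longrightarrow> (w, w) \<in> word_cong S R"
| sym: "(u, v) \<in> word_cong S R \<Longrightarrow> (v, u) \<in> word_cong S R"
| trans: "(u, v) \<in> word_cong S R \<Longrightarrow> (v, w) \<in> word_cong S R \<Longrightarrow> (u, w) \<in> word_cong S R"
| append: "(u, u') \<in> word_cong S R \<Longrightarrow> (v, v') \<in> word_cong S R \<Longrightarrow> (u @ v, u' @ v') \<in> word_cong S R"
| cancel: "x \<in> S \<Longrightarrow> ([(x, b), (x, \<not> b)], []) \<in> word_cong S R"
| rel: "(u, v) \<in> R \<Longrightarrow> u \<in> words S \<Longrightarrow> v \<in> words S \<Longrightarrow> (u, v) \<in> word_cong S R"

definition presented_group ::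
    "'g set \<Rightarrow> ('g word \<times> 'g word) set \<Rightarrow> 'g word set monoid" where
  "presented_group S R =
    \<lparr>carrier = words S // word_cong S R,
     mult = (\<lambda>A B. \<Union>u\<in>A. \<Union>v\<in>B. word_cong S R `` {u @ v}),
     one = word_cong S R `` {[]}\<rparr>"

definition gen_class :: "'g set \<Rightarrow> ('g word \<times> 'g word) set \<Rightarrow> 'g \<Rightarrow> 'g word set" where
  "gen_class S R x = word_cong S R `` {[(x, True)]}"

lemma word_cong_words:
  "(u, v) \<in> word_cong S R \<Longrightarrow> u \<in> words S \<and> v \<in> words S"
  by (induction rule: word_cong.induct) auto

lemma equiv_word_cong: "equiv (words S) (word_cong S R)"
proof (rule equivI)
  show "word_cong S R \<subseteq> words S \<times> words S"
    by (auto dest: word_cong_words simp del: in_lists_conv_set)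
  show "refl_on (words S) (word_cong S R)"
    by (auto simp: refl_on_def intro: word_cong.refl)
  show "sym (word_cong S R)"
    by (auto intro: symI word_cong.sym)
  show "trans (word_cong S R)"
    by (auto intro: transI word_cong.trans)
qed

lemma presented_group_mult:
  assumes "u \<in> words S" "v \<in> words S"
  shows "word_cong S R `` {u} \<otimes>\<^bsub>presented_group S R\<^esub> word_cong S R `` {v} =
    word_cong S R `` {u @ v}"
proof -
  have "congruent2 (word_cong S R) (word_cong S R) (\<lambda>u v. word_cong S R `` {u @ v})"
    by (auto intro!: congruent2I' equiv_class_eq[OF equiv_word_cong] word_cong.append)
  then show ?thesis
    using assms
    by (simp add: presented_group_def UN_equiv_class2[OF equiv_word_cong equiv_word_cong])
qed

lemma carrier_presented_group:
  "carrier (presented_group S R) = (\<lambda>w. word_cong S R `` {w}) ` words S"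
  by (auto simp: presented_group_def quotient_def)

lemma one_presented_group: "\<one>\<^bsub>presented_group S R\<^esub> = word_cong S R `` {[]}"
  by (simp add: presented_group_def)

lemma word_inverse:
  assumes "w \<in> words S"
  shows "\<exists>w'\<in>words S. (w' @ w, []) \<in> word_cong S R"
  using assms
proof (induction w)
  case Nil
  then show ?case by (auto intro: word_cong.refl)
next
  case (Cons a w)
  obtain x b where a: "a = (x, b)" by (cases a)
  with Cons have x: "x \<in> S" and w: "w \<in> words S" by auto
  from Cons obtain w' where w': "w' \<in> words S" "(w' @ w, []) \<in> word_cong S R" by auto
  have "([(x, \<not> b), (x, b)], []) \<in> word_cong S R"
    using word_cong.cancel[OF x, of "\<not> b"] by simp
  from word_cong.append[OF word_cong.refl[OF w'(1)] word_cong.append[OF this word_cong.refl[OF w]]]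
  have "(w' @ [(x, \<not> b), (x, b)] @ w, w' @ w) \<in> word_cong S R" by simp
  then have "((w' @ [(x, \<not> b)]) @ a # w, []) \<in> word_cong S R"
    using w'(2) a by (auto intro: word_cong.trans)
  then show ?case using w'(1) x by (intro bexI[of _ "w' @ [(x, \<not> b)]"]) auto
qed

lemma group_presented_group: "group (presented_group S R)"
proof (rule groupI)
  fix A B C assume "A \<in> carrier (presented_group S R)" "B \<in> carrier (presented_group S R)"
    "C \<in> carrier (presented_group S R)"
  then obtain u v w where "u \<in> words S" "v \<in> words S" "w \<in> words S"
    "A = word_cong S R `` {u}" "B = word_cong S R `` {v}" "C = word_cong S R `` {w}"
    by (auto simp: carrier_presented_group)
  then show "A \<otimes>\<^bsub>presented_group S R\<^esub> B \<otimes>\<^bsub>presented_group S R\<^esub> C =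
      A \<otimes>\<^bsub>presented_group S R\<^esub> (B \<otimes>\<^bsub>presented_group S R\<^esub> C)"
    by (simp add: presented_group_mult del: in_lists_conv_set)
next
  fix A assume "A \<in> carrier (presented_group S R)"
  then obtain u where u: "u \<in> words S" "A = word_cong S R `` {u}"
    by (auto simp: carrier_presented_group)
  then show "\<one>\<^bsub>presented_group S R\<^esub> \<otimes>\<^bsub>presented_group S R\<^esub> A = A"
    by (simp add: presented_group_mult one_presented_group del: in_lists_conv_set)
  obtain u' where u': "u' \<in> words S" "(u' @ u, []) \<in> word_cong S R"
    using word_inverse[OF u(1)] by blast
  then have "word_cong S R `` {u'} \<otimes>\<^bsub>presented_group S R\<^esub> A = \<one>\<^bsub>presented_group S R\<^esub>"
    using u equiv_class_eq[OF equiv_word_cong u'(2)]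
    by (simp add: presented_group_mult one_presented_group del: in_lists_conv_set)
  with u'(1) show "\<exists>B\<in>carrier (presented_group S R).
      B \<otimes>\<^bsub>presented_group S R\<^esub> A = \<one>\<^bsub>presented_group S R\<^esub>"
    by (auto simp: carrier_presented_group)
next
  show "\<one>\<^bsub>presented_group S R\<^esub> \<in> carrier (presented_group S R)"
    by (auto simp: carrier_presented_group one_presented_group)
next
  fix A B assume "A \<in> carrier (presented_group S R)" "B \<in> carrier (presented_group S R)"
  then obtain u v where "u \<in> words S" "v \<in> words S"
    "A = word_cong S R `` {u}" "B = word_cong S R `` {v}"
    by (auto simp: carrier_presented_group)
  then show "A \<otimes>\<^bsub>presented_group S R\<^esub> B \<in> carrier (presented_group S R)"
    by (simp add: presented_group_mult carrier_presented_group del: in_lists_conv_set)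
qed

definition normal_closure :: "('a, 'b) monoid_scheme \<Rightarrow> 'a set \<Rightarrow> 'a set" where
  "normal_closure G X = \<Inter> {N. N \<lhd> G \<and> X \<subseteq> N}"

lemma normal_closure_normal:
  assumes "group G" "X \<subseteq> carrier G"
  shows "normal_closure G X \<lhd> G"
proof -
  interpret group G by fact
  have "carrier G \<lhd> G"
    by (auto simp: normal_inv_iff subgroup_self)
  then have ne: "{N. N \<lhd> G \<and> X \<subseteq> N} \<noteq> {}"
    using assms(2) by blast
  then have "subgroup (normal_closure G X) G"
    unfolding normal_closure_def
    by (intro subgroups_Inter) (auto simp: normal_inv_iff)
  then show ?thesis
    by (auto simp: normal_inv_iff normal_closure_def)
qed

text \<open>The quotient of \<open>G\<close> obtained by imposing \<open>u = v\<close> for all pairs \<open>(u, v)\<close> in \<open>E\<close>.\<close>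

definition add_relations ::
    "('a, 'b) monoid_scheme \<Rightarrow> ('a \<times> 'a) set \<Rightarrow> 'a set monoid" where
  "add_relations G E = G Mod normal_closure G ((\<lambda>(u, v). u \<otimes>\<^bsub>G\<^esub> inv\<^bsub>G\<^esub> v) ` E)"

text \<open>The generator \<open>a\<^sub>i\<^sub>j\<close> is indexed by the unordered pair \<open>{i, j}\<close>, so that \<open>a\<^sub>i\<^sub>j\<close> and \<open>a\<^sub>j\<^sub>i\<close> are
  the same generator.\<close>

datatype gen = A_gen "nat set" | Tau_gen nat

definition aw :: "nat \<Rightarrow> nat \<Rightarrow> gen word" where
  "aw i j = [(A_gen {i, j}, True)]"

definition tw :: "nat \<Rightarrow> gen word" where
  "tw i = [(Tau_gen i, True)]"

definition a_gens :: "nat \<Rightarrow> gen set" where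
  "a_gens m = {A_gen {i, j} | i j. i \<in> {1..m} \<and> j \<in> {1..m} \<and> i < j}"

definition tau_gens :: "nat \<Rightarrow> gen set" where
  "tau_gens m = {Tau_gen i | i. i \<in> {1..m}}"

definition a_rels :: "nat \<Rightarrow> (gen word \<times> gen word) set" where
  "a_rels m =
     {(aw i j @ aw i j, []) | i j. {i, j} \<subseteq> {1..m} \<and> i \<noteq> j} \<union>
     {(aw i j @ aw k l, aw k l @ aw i j) | i j k l. {i, j, k, l} \<subseteq> {1..m} \<and> distinct [i, j, k, l]} \<union>
     {(aw i j @ aw i k @ aw j k, aw j k @ aw i k @ aw i j) | i j k.
        {i, j, k} \<subseteq> {1..m} \<and> distinct [i, j, k]}"

definition tau_rels :: "nat \<Rightarrow> (gen word \<times> gen word) set" where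
  "tau_rels m =
     {(tw i @ tw i, []) | i. i \<in> {1..m}} \<union>
     {(tw i @ tw j, tw j @ tw i) | i j. {i, j} \<subseteq> {1..m}} \<union>
     {(tw i @ tw j @ aw i j @ tw j @ tw i, aw i j) | i j. {i, j} \<subseteq> {1..m} \<and> i \<noteq> j} \<union>
     {(aw i j @ tw k, tw k @ aw i j) | i j k. {i, j, k} \<subseteq> {1..m} \<and> distinct [i, j, k]}"

definition G2 :: "nat \<Rightarrow> gen word set monoid" where
  "G2 m = presented_group (a_gens m) (a_rels m)"

definition G2d :: "nat \<Rightarrow> gen word set monoid" where
  "G2d n = presented_group (a_gens n \<union> tau_gens n) (a_rels n \<union> tau_rels n)"

definition G2_a :: "nat \<Rightarrow> nat \<Rightarrow> nat \<Rightarrow> gen word set" where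
  "G2_a m i j = gen_class (a_gens m) (a_rels m) (A_gen {i, j})"

definition G2_quot :: "nat \<Rightarrow> gen word set set monoid" where
  "G2_quot n = add_relations (G2 (n + 1))
     {(G2_a (n + 1) i (n + 1) \<otimes>\<^bsub>G2 (n + 1)\<^esub> G2_a (n + 1) j (n + 1),
       G2_a (n + 1) j (n + 1) \<otimes>\<^bsub>G2 (n + 1)\<^esub> G2_a (n + 1) i (n + 1)) | i j.
       i \<in> {1..n} \<and> j \<in> {1..n}}"

end

theory Submission
  imports Defs
begin

text \<open>The isomorphism fixes \<open>a\<^sub>i\<^sub>j\<close> for \<open>i, j \<le> n\<close> and sends \<open>\<tau>\<^sub>i\<close> to \<open>a\<^sub>i\<^sub>(\<^sub>n\<^sub>+\<^sub>1\<^sub>)\<close>. Under this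
  dictionary the two sets of defining relations say the same in any group, so both the map and its
  inverse come from the universal properties of presented groups and of quotients.\<close>

section \<open>Evaluation of words and the universal property of presented groups\<close>

fun word_eval :: "('a, 'b) monoid_scheme \<Rightarrow> ('g \<Rightarrow> 'a) \<Rightarrow> 'g word \<Rightarrow> 'a" where
  "word_eval H f [] = \<one>\<^bsub>H\<^esub>"
| "word_eval H f ((x, b) # w) = (if b then f x else inv\<^bsub>H\<^esub> (f x)) \<otimes>\<^bsub>H\<^esub> word_eval H f w"

context group
begin

lemma word_eval_closed:
  assumes "f \<in> S \<rightarrow> carrier G" "w \<in> words S"
  shows "word_eval G f w \<in> carrier G"
  using assms(2)
proof (induction w)
  case (Cons a w)
  then show ?case using assms(1) by (cases a) auto
qed auto

lemma word_eval_append: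
  assumes f: "f \<in> S \<rightarrow> carrier G" and "u \<in> words S" "v \<in> words S"
  shows "word_eval G f (u @ v) = word_eval G f u \<otimes> word_eval G f v"
  using assms(2)
proof (induction u)
  case Nil
  then show ?case using word_eval_closed[OF f assms(3)] by simp
next
  case (Cons a u)
  then have "u \<in> words S" by simp
  with Cons show ?case
    using f word_eval_closed[OF f assms(3)] word_eval_closed[OF f \<open>u \<in> words S\<close>]
    by (cases a) (auto simp: m_assoc Pi_iff)
qed

text \<open>Equality of values is itself an equivalence compatible with concatenation. Cancellation
  of a letter against its inverse holds in every group, so the hypothesis on \<open>R\<close> is all
  that a map of generators has to satisfy.\<close>

lemma word_eval_cong:
  assumes f: "f \<in> S \<rightarrow> carrier G"
    and R: "\<And>u v. (u, v) \<in> R \<Longrightarrow> u \<in> words S \<Longrightarrow> v \<in> words S \<Longrightarrow> word_eval G f u = word_eval G f v"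
    and "(u, v) \<in> word_cong S R"
  shows "word_eval G f u = word_eval G f v"
  using assms(3)
proof (induction rule: word_cong.induct)
  case (sym u v)
  show ?case by (rule sym.IH[symmetric])
next
  case (trans u v w)
  show ?case by (rule HOL.trans[OF trans.IH])
next
  case (append u u' v v')
  have "u \<in> words S" "u' \<in> words S" "v \<in> words S" "v' \<in> words S"
    using append.hyps by (auto dest!: word_cong_words)
  then show ?case
    by (simp only: word_eval_append[OF f] append.IH)
next
  case (cancel x b)
  then have "f x \<in> carrier G" using f by blast
  then show ?case by (cases b) simp_all
next
  case (rel u v)
  then show ?case by (rule R)
qed (rule HOL.refl)

text \<open>Von Dyck's theorem, the existence half of the universal property. The homomorphism
  evaluates an arbitrarily chosen word of the class, and \<open>word_eval_cong\<close> makes the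
  choice irrelevant.\<close>

lemma presented_group_hom_ex:
  assumes f: "f \<in> S \<rightarrow> carrier G"
    and R: "\<And>u v. (u, v) \<in> R \<Longrightarrow> u \<in> words S \<Longrightarrow> v \<in> words S \<Longrightarrow> word_eval G f u = word_eval G f v"
  shows "\<exists>h \<in> hom (presented_group S R) G. \<forall>x\<in>S. h (gen_class S R x) = f x"
proof
  define h where "h A = word_eval G f (SOME w. w \<in> A)" for A
  have h: "h (word_cong S R `` {w}) = word_eval G f w" if "w \<in> words S" for w
  proof -
    have "(SOME u. u \<in> word_cong S R `` {w}) \<in> word_cong S R `` {w}"
      by (rule someI[of "\<lambda>u. u \<in> word_cong S R `` {w}" w]) (simp add: word_cong.refl that)
    then have "(w, SOME u. u \<in> word_cong S R `` {w}) \<in> word_cong S R" by blast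
    then have "word_eval G f w = word_eval G f (SOME u. u \<in> word_cong S R `` {w})"
      by (rule word_eval_cong[OF f, rotated]) (rule R)
    then show ?thesis by (simp only: h_def)
  qed
  show "h \<in> hom (presented_group S R) G"
  proof (rule homI)
    fix A B assume "A \<in> carrier (presented_group S R)" "B \<in> carrier (presented_group S R)"
    then obtain u v where uv: "u \<in> words S" "v \<in> words S"
      and AB: "A = word_cong S R `` {u}" "B = word_cong S R `` {v}"
      unfolding carrier_presented_group by blast
    show "h A \<in> carrier G"
      unfolding AB h[OF uv(1)] by (rule word_eval_closed[OF f uv(1)])
    have "u @ v \<in> words S" using uv by simp
    then show "h (A \<otimes>\<^bsub>presented_group S R\<^esub> B) = h A \<otimes> h B"
      by (simp only: AB presented_group_mult uv h word_eval_append[OF f])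
  qed
  show "\<forall>x\<in>S. h (gen_class S R x) = f x"
    using f by (auto simp: gen_class_def h Pi_iff)
qed

end

lemma gen_class_closed: "x \<in> S \<Longrightarrow> gen_class S R x \<in> carrier (presented_group S R)"
  by (auto simp: gen_class_def carrier_presented_group)

lemma inv_gen_class:
  assumes "x \<in> S"
  shows "inv\<^bsub>presented_group S R\<^esub> (gen_class S R x) = word_cong S R `` {[(x, False)]}"
proof -
  interpret group "presented_group S R" by (rule group_presented_group)
  have "word_cong S R `` {[(x, False)]} \<otimes>\<^bsub>presented_group S R\<^esub> gen_class S R x =
      \<one>\<^bsub>presented_group S R\<^esub>"
    using assms word_cong.cancel[OF assms, of False R]
    by (simp add: gen_class_def presented_group_mult one_presented_group
        equiv_class_eq[OF equiv_word_cong])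
  then show ?thesis
    using gen_class_closed[OF assms] assms
    by (intro inv_equality) (auto simp: carrier_presented_group)
qed

text \<open>Every element of a presented group is thus the value of a word at the generators.
  Congruent words have equal classes, so the generators satisfy the defining relations, as
  \<open>word_eval_rel\<close> records.\<close>

lemma word_eval_gen_class:
  assumes "w \<in> words S"
  shows "word_eval (presented_group S R) (gen_class S R) w = word_cong S R `` {w}"
  using assms
proof (induction w)
  case Nil
  then show ?case by (simp add: one_presented_group)
next
  case (Cons a w)
  obtain x b where a: "a = (x, b)" by (cases a)
  with Cons have x: "x \<in> S" and w: "w \<in> words S" by auto
  have "(if b then gen_class S R x else inv\<^bsub>presented_group S R\<^esub> (gen_class S R x)) =
      word_cong S R `` {[(x, b)]}"
    using inv_gen_class[OF x] by (simp add: gen_class_def)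
  then show ?case
    using presented_group_mult[of "[(x, b)]" S w R] x w Cons a by simp
qed

lemma word_eval_rel:
  assumes "(u, v) \<in> R" "u \<in> words S" "v \<in> words S"
  shows "word_eval (presented_group S R) (gen_class S R) u =
    word_eval (presented_group S R) (gen_class S R) v"
  using assms word_cong.rel[OF assms]
  by (simp add: word_eval_gen_class equiv_class_eq[OF equiv_word_cong])

lemma (in group_hom) hom_word_eval:
  assumes f: "f \<in> S \<rightarrow> carrier G" and "w \<in> words S"
  shows "h (word_eval G f w) = word_eval H (h \<circ> f) w"
  using assms(2)
proof (induction w)
  case (Cons a w)
  then have "w \<in> words S" by simp
  with Cons show ?case
    using f G.word_eval_closed[OF f \<open>w \<in> words S\<close>]
    by (cases a) (auto simp: Pi_iff)
qed simp

lemma word_eval_eqI: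
  assumes "w \<in> words S" "\<And>x. x \<in> S \<Longrightarrow> f x = g x"
  shows "word_eval H f w = word_eval H g w"
  using assms(1)
proof (induction w)
  case (Cons a w)
  then show ?case using assms(2) by (cases a) auto
qed simp

text \<open>The uniqueness half of the universal property: each element is a word in the generators,
  and homomorphisms commute with evaluation of words.\<close>

lemma hom_presented_group_eqI:
  assumes "group H" "h \<in> hom (presented_group S R) H" "k \<in> hom (presented_group S R) H"
    and eq: "\<And>x. x \<in> S \<Longrightarrow> h (gen_class S R x) = k (gen_class S R x)"
    and A: "A \<in> carrier (presented_group S R)"
  shows "h A = k A"
proof -
  interpret h: group_hom "presented_group S R" H h
    by (intro group_hom.intro group_hom_axioms.intro group_presented_group assms)
  interpret k: group_hom "presented_group S R" H k
    by (intro group_hom.intro group_hom_axioms.intro group_presented_group assms)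
  obtain w where w: "w \<in> words S" "A = word_eval (presented_group S R) (gen_class S R) w"
    using A by (auto simp: carrier_presented_group word_eval_gen_class)
  have g: "gen_class S R \<in> S \<rightarrow> carrier (presented_group S R)"
    by (auto intro: gen_class_closed)
  show ?thesis
    unfolding w(2) h.hom_word_eval[OF g w(1)] k.hom_word_eval[OF g w(1)]
    by (rule word_eval_eqI[OF w(1)]) (simp add: eq)
qed

section \<open>Imposing further relations on a group\<close>

abbreviation rel_closure :: "('a, 'b) monoid_scheme \<Rightarrow> ('a \<times> 'a) set \<Rightarrow> 'a set" where
  "rel_closure G E \<equiv> normal_closure G ((\<lambda>(u, v). u \<otimes>\<^bsub>G\<^esub> inv\<^bsub>G\<^esub> v) ` E)"

context group
begin

lemma normal_rel_closure: "E \<subseteq> carrier G \<times> carrier G \<Longrightarrow> rel_closure G E \<lhd> G"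
  by (intro normal_closure_normal is_group) auto

lemma group_add_relations: "E \<subseteq> carrier G \<times> carrier G \<Longrightarrow> group (add_relations G E)"
  unfolding add_relations_def by (intro normal.factorgroup_is_group normal_rel_closure)

lemma rcos_hom_add_relations:
  "E \<subseteq> carrier G \<times> carrier G \<Longrightarrow> (\<lambda>x. rel_closure G E #> x) \<in> hom G (add_relations G E)"
  unfolding add_relations_def by (intro normal.r_coset_hom_Mod normal_rel_closure)

lemma carrier_add_relations:
  "carrier (add_relations G E) = (\<lambda>x. rel_closure G E #> x) ` carrier G"
  by (simp add: add_relations_def carrier_FactGroup)

text \<open>The element \<open>u \<otimes> inv v\<close> lies in every normal subgroup that contains
  the relators, hence in the closure, and multiplying it by \<open>v\<close> on the right gives
  \<open>u\<close>.\<close>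

lemma rcos_add_relations_eq:
  assumes E: "E \<subseteq> carrier G \<times> carrier G" and "(u, v) \<in> E"
  shows "rel_closure G E #> u = rel_closure G E #> v"
proof -
  have uv: "u \<in> carrier G" "v \<in> carrier G" using assms by auto
  have "u \<otimes> inv v \<in> rel_closure G E"
    using assms(2) unfolding normal_closure_def by force
  then have "u \<in> rel_closure G E #> v"
    using uv by (auto simp: r_coset_def m_assoc intro!: bexI[of _ "u \<otimes> inv v"])
  then show ?thesis
    using repr_independence[OF _ uv(2) normal_imp_subgroup[OF normal_rel_closure[OF E]]] by simp
qed

end

text \<open>The kernel of \<open>h\<close> is normal and contains every relator, so it contains the
  normal closure and \<open>h\<close> factors through the quotient.\<close>

lemma (in group_hom) add_relations_hom_ex:
  assumes E: "E \<subseteq> carrier G \<times> carrier G" and eq: "\<And>u v. (u, v) \<in> E \<Longrightarrow> h u = h v"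
  shows "\<exists>k \<in> hom (add_relations G E) H. \<forall>x\<in>carrier G. k (rel_closure G E #> x) = h x"
proof -
  have "(\<lambda>(u, v). u \<otimes> inv v) ` E \<subseteq> kernel G H h"
    using E eq by (auto simp: kernel_def)
  then have "rel_closure G E \<subseteq> kernel G H h"
    using normal_kernel by (auto simp: normal_closure_def)
  with G.normal_rel_closure[OF E] show ?thesis
    unfolding add_relations_def by (metis FactGroup_universal_kernel)
qed

section \<open>The defining relations as equations between elements of an arbitrary group\<close>

definition a_rels_hold :: "('a, 'b) monoid_scheme \<Rightarrow> (nat \<Rightarrow> nat \<Rightarrow> 'a) \<Rightarrow> nat \<Rightarrow> bool" where
  "a_rels_hold G a m \<longleftrightarrow>
     (\<forall>i j. {i, j} \<subseteq> {1..m} \<and> i \<noteq> j \<longrightarrow> a i j \<otimes>\<^bsub>G\<^esub> a i j = \<one>\<^bsub>G\<^esub>) \<and>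
     (\<forall>i j k l. {i, j, k, l} \<subseteq> {1..m} \<and> distinct [i, j, k, l] \<longrightarrow>
        a i j \<otimes>\<^bsub>G\<^esub> a k l = a k l \<otimes>\<^bsub>G\<^esub> a i j) \<and>
     (\<forall>i j k. {i, j, k} \<subseteq> {1..m} \<and> distinct [i, j, k] \<longrightarrow>
        a i j \<otimes>\<^bsub>G\<^esub> (a i k \<otimes>\<^bsub>G\<^esub> a j k) = a j k \<otimes>\<^bsub>G\<^esub> (a i k \<otimes>\<^bsub>G\<^esub> a i j))"

definition tau_rels_hold ::
    "('a, 'b) monoid_scheme \<Rightarrow> (nat \<Rightarrow> nat \<Rightarrow> 'a) \<Rightarrow> (nat \<Rightarrow> 'a) \<Rightarrow> nat \<Rightarrow> bool" where
  "tau_rels_hold G a t m \<longleftrightarrow>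
     (\<forall>i. i \<in> {1..m} \<longrightarrow> t i \<otimes>\<^bsub>G\<^esub> t i = \<one>\<^bsub>G\<^esub>) \<and>
     (\<forall>i j. {i, j} \<subseteq> {1..m} \<longrightarrow> t i \<otimes>\<^bsub>G\<^esub> t j = t j \<otimes>\<^bsub>G\<^esub> t i) \<and>
     (\<forall>i j. {i, j} \<subseteq> {1..m} \<and> i \<noteq> j \<longrightarrow>
        t i \<otimes>\<^bsub>G\<^esub> (t j \<otimes>\<^bsub>G\<^esub> (a i j \<otimes>\<^bsub>G\<^esub> (t j \<otimes>\<^bsub>G\<^esub> t i))) = a i j) \<and>
     (\<forall>i j k. {i, j, k} \<subseteq> {1..m} \<and> distinct [i, j, k] \<longrightarrow> a i j \<otimes>\<^bsub>G\<^esub> t k = t k \<otimes>\<^bsub>G\<^esub> a i j)"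

lemma a_rels_hold_cong:
  assumes "\<And>i j. i \<in> {1..m} \<Longrightarrow> j \<in> {1..m} \<Longrightarrow> a i j = b i j"
  shows "a_rels_hold G a m \<longleftrightarrow> a_rels_hold G b m"
  unfolding a_rels_hold_def by (simp only: insert_subset assms cong: imp_cong)

lemma tau_rels_hold_cong:
  assumes "\<And>i j. i \<in> {1..m} \<Longrightarrow> j \<in> {1..m} \<Longrightarrow> a i j = b i j" "\<And>i. i \<in> {1..m} \<Longrightarrow> t i = s i"
  shows "tau_rels_hold G a t m \<longleftrightarrow> tau_rels_hold G b s m"
  unfolding tau_rels_hold_def by (simp only: insert_subset assms cong: imp_cong)

lemma A_gen_in_a_gens: "i \<in> {1..m} \<Longrightarrow> j \<in> {1..m} \<Longrightarrow> i \<noteq> j \<Longrightarrow> A_gen {i, j} \<in> a_gens m"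
  unfolding a_gens_def by (cases i j rule: linorder_cases) (fastforce simp: insert_commute)+

text \<open>Since \<open>word_cong\<close> ignores pairs that are not words over the generators,
  this and the next lemma ensure that every listed relation takes effect.\<close>

lemma a_rels_words: "(u, v) \<in> a_rels m \<Longrightarrow> u \<in> words (a_gens m) \<and> v \<in> words (a_gens m)"
  by (auto simp: a_rels_def aw_def intro!: A_gen_in_a_gens)

lemma tau_rels_words:
  "(u, v) \<in> tau_rels m \<Longrightarrow>
    u \<in> words (a_gens m \<union> tau_gens m) \<and> v \<in> words (a_gens m \<union> tau_gens m)"
  using A_gen_in_a_gens[of _ m] by (fastforce simp: tau_rels_def aw_def tw_def tau_gens_def)

lemma ball_a_rels:
  "(\<forall>(u, v) \<in> a_rels m. P u v) \<longleftrightarrow>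
     (\<forall>i j. {i, j} \<subseteq> {1..m} \<and> i \<noteq> j \<longrightarrow> P (aw i j @ aw i j) []) \<and>
     (\<forall>i j k l. {i, j, k, l} \<subseteq> {1..m} \<and> distinct [i, j, k, l] \<longrightarrow>
        P (aw i j @ aw k l) (aw k l @ aw i j)) \<and>
     (\<forall>i j k. {i, j, k} \<subseteq> {1..m} \<and> distinct [i, j, k] \<longrightarrow>
        P (aw i j @ aw i k @ aw j k) (aw j k @ aw i k @ aw i j))"
  unfolding a_rels_def ball_Un conj_assoc
  by (intro arg_cong2[of _ _ _ _ "(\<and>)"]) fast+

lemma ball_tau_rels:
  "(\<forall>(u, v) \<in> tau_rels m. P u v) \<longleftrightarrow>
     (\<forall>i. i \<in> {1..m} \<longrightarrow> P (tw i @ tw i) []) \<and>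
     (\<forall>i j. {i, j} \<subseteq> {1..m} \<longrightarrow> P (tw i @ tw j) (tw j @ tw i)) \<and>
     (\<forall>i j. {i, j} \<subseteq> {1..m} \<and> i \<noteq> j \<longrightarrow> P (tw i @ tw j @ aw i j @ tw j @ tw i) (aw i j)) \<and>
     (\<forall>i j k. {i, j, k} \<subseteq> {1..m} \<and> distinct [i, j, k] \<longrightarrow> P (aw i j @ tw k) (tw k @ aw i j))"
  unfolding tau_rels_def ball_Un conj_assoc by (intro arg_cong2[of _ _ _ _ "(\<and>)"]) fast+

section \<open>Comparing the relations for n + 1 with those for n and the points\<close>

context group
begin

text \<open>Passes from words to plain equations, so that the two presentations can be compared by
  computing in a group. Evaluation nests products to the right and ends in \<open>\<one>\<close>; as
  \<open>f\<close> has values in the carrier, that factor drops out and the nesting of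
  \<open>a_rels_hold\<close> remains.\<close>

lemma word_eval_a_rels_iff:
  assumes "f \<in> a_gens m \<rightarrow> carrier G"
  shows "(\<forall>(u, v) \<in> a_rels m. word_eval G f u = word_eval G f v) \<longleftrightarrow>
    a_rels_hold G (\<lambda>i j. f (A_gen {i, j})) m"
proof -
  have "f (A_gen {i, j}) \<in> carrier G" if "i \<in> {1..m}" "j \<in> {1..m}" "i \<noteq> j" for i j
    using assms A_gen_in_a_gens[OF that] by blast
  then show ?thesis
    unfolding ball_a_rels a_rels_hold_def by (simp add: aw_def cong: imp_cong)
qed

lemma word_eval_tau_rels_iff:
  assumes "f \<in> a_gens m \<union> tau_gens m \<rightarrow> carrier G"
  shows "(\<forall>(u, v) \<in> tau_rels m. word_eval G f u = word_eval G f v) \<longleftrightarrow>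
    tau_rels_hold G (\<lambda>i j. f (A_gen {i, j})) (\<lambda>i. f (Tau_gen i)) m"
proof -
  have "f (A_gen {i, j}) \<in> carrier G" if "i \<in> {1..m}" "j \<in> {1..m}" "i \<noteq> j" for i j
    using assms A_gen_in_a_gens[OF that] by blast
  moreover have "f (Tau_gen i) \<in> carrier G" if "i \<in> {1..m}" for i
    using assms that by (auto simp: tau_gens_def)
  ultimately show ?thesis
    unfolding ball_tau_rels tau_rels_hold_def by (simp add: aw_def tw_def cong: imp_cong)
qed

text \<open>To be read with a = a_ij, s = tau_i and t = tau_j. Multiplying by s and t and cancelling
  their squares turns each equation into the statement that a commutes with st. The first part is an
  equivalence because it serves both directions of the comparison.\<close>

lemma commuting_involutions:
  assumes [simp]: "a \<in> carrier G" "s \<in> carrier G" "t \<in> carrier G"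
    and ss: "s \<otimes> s = \<one>" and tt: "t \<otimes> t = \<one>" and st: "s \<otimes> t = t \<otimes> s"
  shows "s \<otimes> (t \<otimes> (a \<otimes> (t \<otimes> s))) = a \<longleftrightarrow> a \<otimes> (s \<otimes> t) = t \<otimes> (s \<otimes> a)" (is "?C \<longleftrightarrow> ?F")
    and "s \<otimes> (t \<otimes> (a \<otimes> (t \<otimes> s))) = a \<Longrightarrow> s \<otimes> (a \<otimes> t) = t \<otimes> (a \<otimes> s)"
    and "s \<otimes> (t \<otimes> (a \<otimes> (t \<otimes> s))) = a \<Longrightarrow> s \<otimes> (t \<otimes> a) = a \<otimes> (t \<otimes> s)"
proof -
  have ss': "s \<otimes> (s \<otimes> x) = x" and tt': "t \<otimes> (t \<otimes> x) = x" if "x \<in> carrier G" for x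
    using that by (simp_all add: ss tt flip: m_assoc)
  have ts: "t \<otimes> (s \<otimes> x) = s \<otimes> (t \<otimes> x)" if "x \<in> carrier G" for x
    using that by (simp add: st flip: m_assoc)
  \<comment> \<open>These rules move s to the left of an adjacent t and cancel squares.\<close>
  note simps = m_assoc ss' tt' ss tt ts st[symmetric]
  show iff: "?C \<longleftrightarrow> ?F"
  proof
    assume C: ?C
    have "t \<otimes> (s \<otimes> a) = t \<otimes> (s \<otimes> (s \<otimes> (t \<otimes> (a \<otimes> (t \<otimes> s)))))" by (simp only: C)
    then show ?F by (simp add: simps)
  next
    assume F: ?F
    have "s \<otimes> (t \<otimes> (a \<otimes> (t \<otimes> s))) = s \<otimes> (t \<otimes> (t \<otimes> (s \<otimes> a)))" by (simp only: st[symmetric] F)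
    then show ?C by (simp add: simps)
  qed
  assume C: ?C
  have "s \<otimes> (a \<otimes> t) = s \<otimes> ((s \<otimes> (t \<otimes> (a \<otimes> (t \<otimes> s)))) \<otimes> t)" by (simp only: C)
  then show "s \<otimes> (a \<otimes> t) = t \<otimes> (a \<otimes> s)" by (simp add: simps)
  show "s \<otimes> (t \<otimes> a) = a \<otimes> (t \<otimes> s)" using C iff by (simp add: simps)
qed

text \<open>The triple relation of \<open>i\<close>, \<open>j\<close> and \<open>n + 1\<close> comes in three shapes, according to the position
  of \<open>n + 1\<close>; since the \<open>\<tau>\<close>s are commuting involutions, each of them says that
  \<open>a\<^sub>i\<^sub>j\<close> commutes with \<open>\<tau>\<^sub>i \<tau>\<^sub>j\<close>.\<close>

lemma a_rels_hold_Suc_iff: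
  assumes cl: "\<And>i j. i \<in> {1..n + 1} \<Longrightarrow> j \<in> {1..n + 1} \<Longrightarrow> i \<noteq> j \<Longrightarrow> a i j \<in> carrier G"
    and sym: "\<And>i j. a i j = a j i"
  shows "a_rels_hold G a (n + 1) \<and>
      (\<forall>i\<in>{1..n}. \<forall>j\<in>{1..n}. a i (n + 1) \<otimes> a j (n + 1) = a j (n + 1) \<otimes> a i (n + 1)) \<longleftrightarrow>
    a_rels_hold G a n \<and> tau_rels_hold G a (\<lambda>i. a i (n + 1)) n"
    (is "?L \<and> ?comm \<longleftrightarrow> ?M \<and> ?T")
proof
  assume L: "?L \<and> ?comm"
  have sq: "a i j \<otimes> a i j = \<one>" if "{i, j} \<subseteq> {1..n + 1}" "i \<noteq> j" for i j
    using L that unfolding a_rels_hold_def by blast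
  have far: "a i j \<otimes> a k l = a k l \<otimes> a i j" if "{i, j, k, l} \<subseteq> {1..n + 1}" "distinct [i, j, k, l]" for i j k l
    using L that unfolding a_rels_hold_def by blast
  have tri: "a i j \<otimes> (a i k \<otimes> a j k) = a j k \<otimes> (a i k \<otimes> a i j)"
    if "{i, j, k} \<subseteq> {1..n + 1}" "distinct [i, j, k]" for i j k
    using L that unfolding a_rels_hold_def by blast
  have le: "I \<subseteq> {1..n + 1}" if "I \<subseteq> {1..n}" for I using that by fastforce
  have ?M
    unfolding a_rels_hold_def
    by (intro conjI allI impI; elim conjE) (intro sq far tri le; assumption)+
  moreover have ?T
    unfolding tau_rels_hold_def
  proof (intro conjI allI impI; (elim conjE)?)
    fix i j assume ij: "{i, j} \<subseteq> {1..n}"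
    then show comm: "a i (n + 1) \<otimes> a j (n + 1) = a j (n + 1) \<otimes> a i (n + 1)" using L by simp
    assume "i \<noteq> j"
    \<comment> \<open>The triple relation with n + 1 in the last place is the right-hand side of the
      equivalence in \<open>commuting_involutions\<close>.\<close>
    then show "a i (n + 1) \<otimes> (a j (n + 1) \<otimes> (a i j \<otimes> (a j (n + 1) \<otimes> a i (n + 1)))) = a i j"
      using ij sq[of i "n + 1"] sq[of j "n + 1"] tri[of i j "n + 1"] comm
      by (subst commuting_involutions(1)) (auto intro!: cl)
  next
    fix i assume "i \<in> {1..n}"
    then show "a i (n + 1) \<otimes> a i (n + 1) = \<one>" by (intro sq) auto
  next
    fix i j k assume "{i, j, k} \<subseteq> {1..n}" "distinct [i, j, k]"
    then show "a i j \<otimes> a k (n + 1) = a k (n + 1) \<otimes> a i j" by (intro far) auto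
  qed
  ultimately show "?M \<and> ?T" ..
next
  assume MT: "?M \<and> ?T"
  let ?t = "\<lambda>i. a i (n + 1)"
  \<comment> \<open>With n + 1 always written second, each a with an index n + 1 becomes a
    \<open>?t\<close>.\<close>
  have new: "a (n + 1) i = ?t i" for i by (rule sym)
  have sq: "a i j \<otimes> a i j = \<one>" if "i \<in> {1..n}" "j \<in> {1..n}" "i \<noteq> j" for i j
    using MT that unfolding a_rels_hold_def by simp
  have far: "a i j \<otimes> a k l = a k l \<otimes> a i j"
    if "i \<in> {1..n}" "j \<in> {1..n}" "k \<in> {1..n}" "l \<in> {1..n}" "distinct [i, j, k, l]" for i j k l
    using MT that unfolding a_rels_hold_def by simp
  have tri: "a i j \<otimes> (a i k \<otimes> a j k) = a j k \<otimes> (a i k \<otimes> a i j)"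
    if "{i, j, k} \<subseteq> {1..n}" "distinct [i, j, k]" for i j k
    using MT that unfolding a_rels_hold_def by blast
  have tsq: "?t i \<otimes> ?t i = \<one>" if "i \<in> {1..n}" for i
    using MT that unfolding tau_rels_hold_def by simp
  have tcomm: "?t i \<otimes> ?t j = ?t j \<otimes> ?t i" if "i \<in> {1..n}" "j \<in> {1..n}" for i j
    using MT that unfolding tau_rels_hold_def by simp
  have conj: "?t i \<otimes> (?t j \<otimes> (a i j \<otimes> (?t j \<otimes> ?t i))) = a i j"
    if "i \<in> {1..n}" "j \<in> {1..n}" "i \<noteq> j" for i j
    using MT that unfolding tau_rels_hold_def by blast
  have tfar: "a i j \<otimes> ?t k = ?t k \<otimes> a i j"
    if "i \<in> {1..n}" "j \<in> {1..n}" "k \<in> {1..n}" "distinct [i, j, k]" for i j k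
    using MT that unfolding tau_rels_hold_def by simp
  have Suc_cases: "i = n + 1 \<or> i \<in> {1..n}" if "i \<in> {1..n + 1}" for i
    using that by auto
  have tcl: "?t i \<in> carrier G" if "i \<in> {1..n}" for i
    using that by (intro cl) auto
  have acl: "a i j \<in> carrier G" if "i \<in> {1..n}" "j \<in> {1..n}" "i \<noteq> j" for i j
    using that by (intro cl) auto
  \<comment> \<open>In this order, the triple relation with n + 1 as its third, second and first
    index.\<close>
  have shapes: "a i j \<otimes> (?t i \<otimes> ?t j) = ?t j \<otimes> (?t i \<otimes> a i j)"
    "?t i \<otimes> (a i j \<otimes> ?t j) = ?t j \<otimes> (a i j \<otimes> ?t i)"
    "?t i \<otimes> (?t j \<otimes> a i j) = a i j \<otimes> (?t j \<otimes> ?t i)"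
    if ij: "i \<in> {1..n}" "j \<in> {1..n}" "i \<noteq> j" for i j
  proof -
    note comm_inv = commuting_involutions[OF acl[OF ij] tcl[OF ij(1)] tcl[OF ij(2)]
        tsq[OF ij(1)] tsq[OF ij(2)] tcomm[OF ij(1,2)]]
    show "a i j \<otimes> (?t i \<otimes> ?t j) = ?t j \<otimes> (?t i \<otimes> a i j)"
      using comm_inv(1) conj[OF ij] by blast
    show "?t i \<otimes> (a i j \<otimes> ?t j) = ?t j \<otimes> (a i j \<otimes> ?t i)"
      by (rule comm_inv(2)[OF conj[OF ij]])
    show "?t i \<otimes> (?t j \<otimes> a i j) = a i j \<otimes> (?t j \<otimes> ?t i)"
      by (rule comm_inv(3)[OF conj[OF ij]])
  qed
  have ?L
    unfolding a_rels_hold_def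
  proof (intro conjI allI impI; elim conjE)
    fix i j assume "{i, j} \<subseteq> {1..n + 1}" "i \<noteq> j"
    then consider "i \<in> {1..n}" "j \<in> {1..n}" | "i = n + 1" "j \<in> {1..n}" | "i \<in> {1..n}" "j = n + 1"
      using Suc_cases[of i] Suc_cases[of j] by blast
    then show "a i j \<otimes> a i j = \<one>"
      by cases (simp_all only: new sq[OF _ _ \<open>i \<noteq> j\<close>] tsq)
  next
    fix i j k l assume sub: "{i, j, k, l} \<subseteq> {1..n + 1}" and d: "distinct [i, j, k, l]"
    have "i = n + 1 \<or> i \<in> {1..n}" "j = n + 1 \<or> j \<in> {1..n}" "k = n + 1 \<or> k \<in> {1..n}"
      "l = n + 1 \<or> l \<in> {1..n}" using sub Suc_cases by blast+
    \<comment> \<open>Distinct indices include n + 1 at most once, which leaves five cases here and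
      four for the triple relation below.\<close>
    with d consider "i \<in> {1..n}" "j \<in> {1..n}" "k \<in> {1..n}" "l \<in> {1..n}"
      | "i = n + 1" "j \<in> {1..n}" "k \<in> {1..n}" "l \<in> {1..n}"
      | "i \<in> {1..n}" "j = n + 1" "k \<in> {1..n}" "l \<in> {1..n}"
      | "i \<in> {1..n}" "j \<in> {1..n}" "k = n + 1" "l \<in> {1..n}"
      | "i \<in> {1..n}" "j \<in> {1..n}" "k \<in> {1..n}" "l = n + 1"
      by (elim disjE) (simp_all del: atLeastAtMost_iff)
    then show "a i j \<otimes> a k l = a k l \<otimes> a i j"
    proof cases
      case 1
      then show ?thesis using d by (intro far)
    next
      case 2
      then show ?thesis using d tfar[of k l j] by (simp only: new) auto
    next
      case 3
      then show ?thesis using d tfar[of k l i] by auto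
    next
      case 4
      then show ?thesis using d tfar[of i j l] by (simp only: new) auto
    next
      case 5
      then show ?thesis using d tfar[of i j k] by auto
    qed
  next
    fix i j k assume sub: "{i, j, k} \<subseteq> {1..n + 1}" and d: "distinct [i, j, k]"
    have "i = n + 1 \<or> i \<in> {1..n}" "j = n + 1 \<or> j \<in> {1..n}" "k = n + 1 \<or> k \<in> {1..n}"
      using sub Suc_cases by blast+
    with d consider "i \<in> {1..n}" "j \<in> {1..n}" "k \<in> {1..n}"
      | "i = n + 1" "j \<in> {1..n}" "k \<in> {1..n}"
      | "i \<in> {1..n}" "j = n + 1" "k \<in> {1..n}"
      | "i \<in> {1..n}" "j \<in> {1..n}" "k = n + 1"
      by (elim disjE) (simp_all del: atLeastAtMost_iff)
    then show "a i j \<otimes> (a i k \<otimes> a j k) = a j k \<otimes> (a i k \<otimes> a i j)"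
    proof cases
      case 1
      then show ?thesis using d by (intro tri) auto
    next
      case 2
      then show ?thesis using d shapes(3)[of j k] by (simp only: new) auto
    next
      case 3
      then show ?thesis using d shapes(2)[of i k] by (simp only: new) auto
    next
      case 4
      then show ?thesis using d shapes(1)[of i j] by auto
    qed
  qed
  then show "?L \<and> ?comm" using tcomm by blast
qed

text \<open>Generators are indexed by unordered pairs, so the symmetry of the family is automatic.
  The equivalence is applied once in the quotient, from left to right, and once in
  \<open>G2d n\<close>, from right to left.\<close>

lemma a_gens_rels_hold_Suc_iff:
  assumes "f \<in> a_gens (n + 1) \<rightarrow> carrier G"
  shows "a_rels_hold G (\<lambda>i j. f (A_gen {i, j})) (n + 1) \<and>
      (\<forall>i\<in>{1..n}. \<forall>j\<in>{1..n}. f (A_gen {i, n + 1}) \<otimes> f (A_gen {j, n + 1}) =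
        f (A_gen {j, n + 1}) \<otimes> f (A_gen {i, n + 1})) \<longleftrightarrow>
    a_rels_hold G (\<lambda>i j. f (A_gen {i, j})) n \<and>
    tau_rels_hold G (\<lambda>i j. f (A_gen {i, j})) (\<lambda>i. f (A_gen {i, n + 1})) n"
proof (rule a_rels_hold_Suc_iff)
  show "f (A_gen {i, j}) \<in> carrier G" if "i \<in> {1..n + 1}" "j \<in> {1..n + 1}" "i \<noteq> j" for i j
    using assms A_gen_in_a_gens[OF that] by blast
qed (simp add: insert_commute)

end

section \<open>Mutually inverse homomorphisms between \<open>G2d n\<close> and
  \<open>G2_quot n\<close>\<close>

lemma inverse_homs_imp_iso:
  assumes "h \<in> hom G H" "k \<in> hom H G"
    and "\<And>x. x \<in> carrier G \<Longrightarrow> k (h x) = x" "\<And>y. y \<in> carrier H \<Longrightarrow> h (k y) = y"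
  shows "G \<cong> H"
proof (rule is_isoI)
  have "bij_betw h (carrier G) (carrier H)"
    using assms by (intro bij_betw_byWitness[where f' = k]) (auto simp: hom_def)
  then show "h \<in> iso G H" using assms(1) by (simp add: iso_def)
qed

theorem corollary4p3:
  fixes n :: nat
  assumes "n \<ge> 1"
  shows "G2d n \<cong> G2_quot n"
proof -
  let ?SP = "a_gens (n + 1)" and ?RP = "a_rels (n + 1)"
  let ?SD = "a_gens n \<union> tau_gens n" and ?RD = "a_rels n \<union> tau_rels n"
  let ?P = "G2 (n + 1)" and ?D = "G2d n" and ?Q = "G2_quot n"
  define gP where "gP = gen_class ?SP ?RP"
  define gD where "gD = gen_class ?SD ?RD"
  define E where "E = {(gP (A_gen {i, n + 1}) \<otimes>\<^bsub>?P\<^esub> gP (A_gen {j, n + 1}),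
    gP (A_gen {j, n + 1}) \<otimes>\<^bsub>?P\<^esub> gP (A_gen {i, n + 1})) | i j. i \<in> {1..n} \<and> j \<in> {1..n}}"
  define p where "p x = rel_closure ?P E #>\<^bsub>?P\<^esub> x" for x
  have Q: "?Q = add_relations ?P E"
    by (simp add: G2_quot_def E_def G2_a_def gP_def)
  interpret P: group ?P unfolding G2_def by (rule group_presented_group)
  interpret D: group ?D unfolding G2d_def by (rule group_presented_group)
  have gP: "gP \<in> ?SP \<rightarrow> carrier ?P"
    by (auto simp: gP_def G2_def gen_class_closed)
  have gD: "gD \<in> ?SD \<rightarrow> carrier ?D"
    using gen_class_closed[of _ ?SD ?RD] by (auto simp: gD_def G2d_def)
  have last_gen: "A_gen {i, n + 1} \<in> ?SP" if "i \<in> {1..n}" for i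
    using that by (intro A_gen_in_a_gens) auto
  have mono: "a_gens n \<subseteq> ?SP" by (fastforce simp: a_gens_def)
  have gP_last: "gP (A_gen {i, n + 1}) \<in> carrier ?P" if "i \<in> {1..n}" for i
    using gP last_gen[OF that] by blast
  have E: "E \<subseteq> carrier ?P \<times> carrier ?P"
    using P.m_closed[OF gP_last gP_last] unfolding E_def by blast
  interpret Q: group ?Q unfolding Q by (rule P.group_add_relations[OF E])
  have p: "p \<in> hom ?P ?Q"
    unfolding Q p_def[abs_def] by (rule P.rcos_hom_add_relations[OF E])
  interpret p: group_hom ?P ?Q p by unfold_locales (rule p)

  \<comment> \<open>Both presentations draw on the type \<open>gen\<close>, so a generator
    \<open>A_gen s\<close> of \<open>G2d n\<close> names its own counterpart in
    \<open>G2 (n + 1)\<close>.\<close>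
  define f where "f x = (case x of A_gen s \<Rightarrow> p (gP x) | Tau_gen i \<Rightarrow> p (gP (A_gen {i, n + 1})))" for x
  have f: "f \<in> ?SD \<rightarrow> carrier ?Q"
  proof
    fix x assume "x \<in> ?SD"
    then show "f x \<in> carrier ?Q"
    proof
      assume x: "x \<in> a_gens n"
      obtain s where "x = A_gen s" using x by (auto simp: a_gens_def)
      moreover have "gP x \<in> carrier ?P" using x gP mono by blast
      ultimately show ?thesis by (simp add: f_def)
    next
      assume "x \<in> tau_gens n"
      then show ?thesis using gP_last by (auto simp: f_def tau_gens_def)
    qed
  qed
  have pg: "p \<circ> gP \<in> ?SP \<rightarrow> carrier ?Q"
    using gP p.hom_closed by (simp only: Pi_iff comp_apply) blast
  \<comment> \<open>The relations hold for the generators of \<open>G2 (n + 1)\<close>, and the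
    projection \<open>p\<close> carries them to the quotient.\<close>
  have "\<forall>(u, v) \<in> ?RP. word_eval ?Q (p \<circ> gP) u = word_eval ?Q (p \<circ> gP) v"
  proof clarify
    fix u v assume uv: "(u, v) \<in> ?RP"
    then have w: "u \<in> words ?SP" "v \<in> words ?SP" using a_rels_words by blast+
    have "word_eval ?P gP u = word_eval ?P gP v"
      unfolding gP_def G2_def by (rule word_eval_rel[OF uv w])
    then show "word_eval ?Q (p \<circ> gP) u = word_eval ?Q (p \<circ> gP) v"
      using p.hom_word_eval[OF gP] w by metis
  qed
  then have "a_rels_hold ?Q (\<lambda>i j. p (gP (A_gen {i, j}))) (n + 1)"
    unfolding Q.word_eval_a_rels_iff[OF pg] by simp
  moreover have "p (gP (A_gen {i, n + 1})) \<otimes>\<^bsub>?Q\<^esub> p (gP (A_gen {j, n + 1})) =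
      p (gP (A_gen {j, n + 1})) \<otimes>\<^bsub>?Q\<^esub> p (gP (A_gen {i, n + 1}))" if "i \<in> {1..n}" "j \<in> {1..n}" for i j
  proof -
    have "gP (A_gen {i, n + 1}) \<in> carrier ?P" "gP (A_gen {j, n + 1}) \<in> carrier ?P"
      using that gP_last by blast+
    moreover have "p (gP (A_gen {i, n + 1}) \<otimes>\<^bsub>?P\<^esub> gP (A_gen {j, n + 1})) =
        p (gP (A_gen {j, n + 1}) \<otimes>\<^bsub>?P\<^esub> gP (A_gen {i, n + 1}))"
      using that unfolding p_def by (intro P.rcos_add_relations_eq[OF E]) (auto simp: E_def)
    ultimately show ?thesis by (simp only: p.hom_mult)
  qed
  ultimately have "a_rels_hold ?Q (\<lambda>i j. p (gP (A_gen {i, j}))) n \<and>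
      tau_rels_hold ?Q (\<lambda>i j. p (gP (A_gen {i, j}))) (\<lambda>i. p (gP (A_gen {i, n + 1}))) n"
    using Q.a_gens_rels_hold_Suc_iff[OF pg] unfolding comp_apply by blast
  moreover have "f \<in> a_gens n \<rightarrow> carrier ?Q" using f by auto
  ultimately have "\<forall>(u, v) \<in> ?RD. word_eval ?Q f u = word_eval ?Q f v"
    unfolding ball_Un using f
    by (simp only: Q.word_eval_a_rels_iff Q.word_eval_tau_rels_iff) (simp add: f_def)
  then obtain h where h: "h \<in> hom ?D ?Q" "\<And>x. x \<in> ?SD \<Longrightarrow> h (gD x) = f x"
    using Q.presented_group_hom_ex[OF f, of ?RD] unfolding G2d_def gD_def by blast

  \<comment> \<open>For s = {i, n + 1} with i at most n, \<open>Min s\<close> recovers i from the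
    unordered pair. The value at \<open>Tau_gen\<close> is a default.\<close>
  define g where "g x = (case x of
    A_gen s \<Rightarrow> if n + 1 \<in> s then gD (Tau_gen (Min s)) else gD x | Tau_gen i \<Rightarrow> \<one>\<^bsub>?D\<^esub>)" for x
  have g_old: "g (A_gen {i, j}) = gD (A_gen {i, j})" if "i \<in> {1..n}" "j \<in> {1..n}" for i j
    using that by (auto simp: g_def)
  have g_last: "g (A_gen {i, n + 1}) = gD (Tau_gen i)" if "i \<in> {1..n}" for i
    using that by (auto simp: g_def)
  have g: "g \<in> ?SP \<rightarrow> carrier ?D"
  proof
    fix x assume "x \<in> ?SP"
    then obtain i j where x: "x = A_gen {i, j}" "i \<in> {1..n + 1}" "j \<in> {1..n + 1}" "i < j"
      by (auto simp: a_gens_def)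
    then have i: "i \<in> {1..n}" by auto
    show "g x \<in> carrier ?D"
    proof (cases "j = n + 1")
      case True
      then show ?thesis using g_last[OF i] i gD by (auto simp: x(1) tau_gens_def)
    next
      case False
      then have "j \<in> {1..n}" using x by auto
      then show ?thesis using g_old[OF i] i x(4) gD A_gen_in_a_gens[OF i] by (auto simp: x(1))
    qed
  qed
  have "\<forall>(u, v) \<in> ?RD. word_eval ?D gD u = word_eval ?D gD v"
  proof clarify
    fix u v assume uv: "(u, v) \<in> ?RD"
    then have "u \<in> words ?SD" "v \<in> words ?SD"
      using a_rels_words[of u v n] tau_rels_words[of u v n] by auto
    then show "word_eval ?D gD u = word_eval ?D gD v"
      unfolding gD_def G2d_def by (rule word_eval_rel[OF uv])
  qed
  then have "a_rels_hold ?D (\<lambda>i j. gD (A_gen {i, j})) n"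
    and "tau_rels_hold ?D (\<lambda>i j. gD (A_gen {i, j})) (\<lambda>i. gD (Tau_gen i)) n"
    using gD D.word_eval_a_rels_iff[of gD n] D.word_eval_tau_rels_iff[of gD n]
    unfolding ball_Un by blast+
  moreover have "a_rels_hold ?D (\<lambda>i j. g (A_gen {i, j})) n \<longleftrightarrow>
      a_rels_hold ?D (\<lambda>i j. gD (A_gen {i, j})) n"
    by (rule a_rels_hold_cong) (rule g_old)
  moreover have "tau_rels_hold ?D (\<lambda>i j. g (A_gen {i, j})) (\<lambda>i. g (A_gen {i, n + 1})) n \<longleftrightarrow>
      tau_rels_hold ?D (\<lambda>i j. gD (A_gen {i, j})) (\<lambda>i. gD (Tau_gen i)) n"
    by (rule tau_rels_hold_cong) (rule g_old g_last; assumption)+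
  ultimately have "a_rels_hold ?D (\<lambda>i j. g (A_gen {i, j})) n \<and>
    tau_rels_hold ?D (\<lambda>i j. g (A_gen {i, j})) (\<lambda>i. g (A_gen {i, n + 1})) n"
    by blast
  \<comment> \<open>\<open>ga\<close> gives a homomorphism \<open>k0\<close> on
    \<open>G2 (n + 1)\<close>, and \<open>gc\<close> lets it descend to the quotient as
    \<open>k\<close>.\<close>
  then have ga: "a_rels_hold ?D (\<lambda>i j. g (A_gen {i, j})) (n + 1)"
    and gc: "\<forall>i\<in>{1..n}. \<forall>j\<in>{1..n}. g (A_gen {i, n + 1}) \<otimes>\<^bsub>?D\<^esub> g (A_gen {j, n + 1}) =
      g (A_gen {j, n + 1}) \<otimes>\<^bsub>?D\<^esub> g (A_gen {i, n + 1})"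
    using D.a_gens_rels_hold_Suc_iff[OF g] by blast+
  from ga have "\<forall>(u, v) \<in> ?RP. word_eval ?D g u = word_eval ?D g v"
    using g by (simp add: D.word_eval_a_rels_iff)
  then obtain k0 where k0: "k0 \<in> hom ?P ?D" "\<And>x. x \<in> ?SP \<Longrightarrow> k0 (gP x) = g x"
    using D.presented_group_hom_ex[OF g, of ?RP] unfolding G2_def gP_def by blast
  interpret k0: group_hom ?P ?D k0 by unfold_locales (rule k0)
  have "k0 u = k0 v" if uvE: "(u, v) \<in> E" for u v
  proof -
    obtain i j where ij: "i \<in> {1..n}" "j \<in> {1..n}"
      and uv: "u = gP (A_gen {i, n + 1}) \<otimes>\<^bsub>?P\<^esub> gP (A_gen {j, n + 1})"
        "v = gP (A_gen {j, n + 1}) \<otimes>\<^bsub>?P\<^esub> gP (A_gen {i, n + 1})"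
      using uvE unfolding E_def by blast
    show ?thesis
      unfolding uv using gc ij by (simp only: k0.hom_mult gP_last k0(2) last_gen)
  qed
  then obtain k where k: "k \<in> hom ?Q ?D" "\<And>x. x \<in> carrier ?P \<Longrightarrow> k (p x) = k0 x"
    using k0.add_relations_hom_ex[OF E] unfolding Q p_def by blast

  have kh: "(k \<circ> h) x = id x" if "x \<in> carrier ?D" for x
  proof (rule hom_presented_group_eqI[OF D.is_group, where h = "k \<circ> h" and k = id])
    show "k \<circ> h \<in> hom (presented_group ?SD ?RD) ?D"
      using hom_compose[OF h(1) k(1)] by (simp add: G2d_def)
    show "id \<in> hom (presented_group ?SD ?RD) ?D" by (simp add: G2d_def hom_def)
    show "(k \<circ> h) (gen_class ?SD ?RD y) = id (gen_class ?SD ?RD y)" if "y \<in> ?SD" for y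
    proof -
      have "k (f y) = gD y"
        using that
      proof
        assume y: "y \<in> a_gens n"
        then obtain i j where ij: "y = A_gen {i, j}" "i \<in> {1..n}" "j \<in> {1..n}"
          by (auto simp: a_gens_def)
        then show ?thesis
          using y mono gP k0(2)[of y] g_old[OF ij(2,3)] by (auto simp: f_def k(2) Pi_iff)
      next
        assume "y \<in> tau_gens n"
        then obtain i where i: "y = Tau_gen i" "i \<in> {1..n}" by (auto simp: tau_gens_def)
        have "gP (A_gen {i, n + 1}) \<in> carrier ?P" using gP last_gen[OF i(2)] by blast
        then show ?thesis
          using k0(2)[OF last_gen[OF i(2)]] g_last[OF i(2)] k(2) i(1) by (simp add: f_def)
      qed
      then show ?thesis using h(2)[OF that] by (simp add: gD_def)
    qed
  qed (use that in \<open>simp add: G2d_def\<close>)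

  \<comment> \<open>The uniqueness lemma concerns maps out of a presented group, so h after k is
    compared with the identity only after composing with \<open>p\<close>. Surjectivity of
    \<open>p\<close> then gives the claim on the quotient.\<close>
  have hk: "(h \<circ> k0) x = p x" if "x \<in> carrier ?P" for x
  proof (rule hom_presented_group_eqI[OF Q.is_group, where h = "h \<circ> k0" and k = p])
    show "h \<circ> k0 \<in> hom (presented_group ?SP ?RP) ?Q"
      using hom_compose[OF k0(1) h(1)] by (simp add: G2_def)
    show "p \<in> hom (presented_group ?SP ?RP) ?Q" using p by (simp add: G2_def)
    show "(h \<circ> k0) (gen_class ?SP ?RP y) = p (gen_class ?SP ?RP y)" if yP: "y \<in> ?SP" for y
    proof -
      obtain i j where y: "y = A_gen {i, j}" "i \<in> {1..n + 1}" "j \<in> {1..n + 1}" "i < j"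
        using yP by (auto simp: a_gens_def)
      then have i: "i \<in> {1..n}" by auto
      have "h (g y) = p (gP y)"
      proof (cases "j = n + 1")
        case True
        then show ?thesis
          using g_last[OF i] i h(2)[of "Tau_gen i"] by (simp add: y(1) tau_gens_def f_def)
      next
        case False
        then have "j \<in> {1..n}" using y by auto
        then show ?thesis
          using g_old[OF i] i y(4) h(2)[of y] A_gen_in_a_gens[OF i, of j] by (simp add: y(1) f_def)
      qed
      then show ?thesis using k0(2)[OF yP] by (simp add: gP_def)
    qed
  qed (use that in \<open>simp add: G2_def\<close>)

  show ?thesis
  proof (rule inverse_homs_imp_iso[OF h(1) k(1)])
    show "k (h x) = x" if "x \<in> carrier ?D" for x using kh[OF that] by simp
    show "h (k y) = y" if yQ: "y \<in> carrier ?Q" for y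
    proof -
      obtain x where "x \<in> carrier ?P" "y = p x"
        using yQ unfolding Q P.carrier_add_relations p_def by blast
      then show ?thesis using hk k(2) by simp
    qed
  qed
qed

end
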